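(* Let $1<p<\infty$ and let $T\in\mathcal L(\ell_p)$. Then $W_e(T)$ is a compact convex subset of $\mathbb C$.
   Context: $\ell_p=\ell_p(\mathbb N)$ is the complex sequence space and $\mathcal L(\ell_p)$ its algebra of bounded linear operators. With $1/p+1/q=1$, the dual $(\ell_p)^*$ is identified with $\ell_q$ via $\langle x,y\rangle=\sum_j x_j\overline{y_j}$. For $x=(x_j)\in\ell_p$ put $J(x)=(x_j|x_j|^{p-2})_j\in\ell_q$ (with $0$ in the coordinates where $x_j=0$); for a unit vector $x$, $J(x)$ is its unique norming functional. The essential numerical range $W_e(T)$ is the set of all $\lambda\in\mathbb C$ for which there is a net (equivalently, a sequence) of unit vectors $x_\alpha\in\ell_p$ with $x_\alpha\to0$ weakly and $\langle Tx_\alpha,J(x_\alpha)\rangle\to\lambda$. *)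

theory Defs
  imports "HOL-Analysis.Analysis"
begin

text \<open>
  The complex space $\ell_p$ as a carrier set of sequences (a type of its own is not possible,
  since \<open>p\<close> is a real parameter), and bounded operators relativised to that carrier.
\<close>

definition ell :: "real \<Rightarrow> (nat \<Rightarrow> complex) set" where
  "ell p = {x. summable (\<lambda>j. cmod (x j) powr p)}"

definition ell_norm :: "real \<Rightarrow> (nat \<Rightarrow> complex) \<Rightarrow> real" where
  "ell_norm p x = (\<Sum>j. cmod (x j) powr p) powr (1 / p)"

text \<open>The values of an operator outside the carrier are unconstrained and never used.\<close>

definition bounded_operators :: "real \<Rightarrow> ((nat \<Rightarrow> complex) \<Rightarrow> (nat \<Rightarrow> complex)) set" where
  "bounded_operators p = {T.
     (\<forall>x\<in>ell p. T x \<in> ell p) \<and>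
     (\<forall>x\<in>ell p. \<forall>y\<in>ell p. T (\<lambda>j. x j + y j) = (\<lambda>j. T x j + T y j)) \<and>
     (\<forall>c. \<forall>x\<in>ell p. T (\<lambda>j. c * x j) = (\<lambda>j. c * T x j)) \<and>
     (\<exists>C. \<forall>x\<in>ell p. ell_norm p (T x) \<le> C * ell_norm p x)}"

text \<open>The solution \<open>q\<close> of \<open>1 / p + 1 / q = 1\<close>, for \<open>p > 1\<close>.\<close>

definition conj_exponent :: "real \<Rightarrow> real" where
  "conj_exponent p = p / (p - 1)"

definition pairing :: "(nat \<Rightarrow> complex) \<Rightarrow> (nat \<Rightarrow> complex) \<Rightarrow> complex" where
  "pairing x y = (\<Sum>j. x j * cnj (y j))"

text \<open>Coordinates with \<open>x j = 0\<close> give \<open>0\<close>, also when \<open>p < 2\<close>.\<close>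

definition duality_map :: "real \<Rightarrow> (nat \<Rightarrow> complex) \<Rightarrow> (nat \<Rightarrow> complex)" where
  "duality_map p x = (\<lambda>j. x j * of_real (cmod (x j) powr (p - 2)))"

text \<open>
  Weak convergence to \<open>0\<close> of a sequence in $\ell_p$, the dual of $\ell_p$ being identified
  with $\ell_q$ through the pairing.
\<close>

definition weakly_null :: "real \<Rightarrow> (nat \<Rightarrow> nat \<Rightarrow> complex) \<Rightarrow> bool" where
  "weakly_null p x \<longleftrightarrow>
     (\<forall>y\<in>ell (conj_exponent p). (\<lambda>n. pairing (x n) y) \<longlonglongrightarrow> 0)"

definition essential_numerical_range ::
    "real \<Rightarrow> ((nat \<Rightarrow> complex) \<Rightarrow> (nat \<Rightarrow> complex)) \<Rightarrow> complex set" where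
  "essential_numerical_range p T = {l. \<exists>x :: nat \<Rightarrow> nat \<Rightarrow> complex.
     (\<forall>n. x n \<in> ell p \<and> ell_norm p (x n) = 1) \<and>
     weakly_null p x \<and>
     (\<lambda>n. pairing (T (x n)) (duality_map p (x n))) \<longlonglongrightarrow> l}"

end

theory Submission
  imports Defs
begin

text \<open>
  Write $B(x, y) = \langle Tx, J(y) \rangle$ (\<open>duality_form\<close>). A weakly null sequence of
  unit vectors drifts out to infinity, and after truncation it consists of finitely supported
  vectors that live beyond any prescribed index. So if $V_N$ (\<open>tail_range\<close>) denotes the set of
  all $B(x, x)$ with $x$ a finitely supported unit vector that vanishes below $N$, then the
  essential numerical range
  is $\bigcap_N \overline{V_N}$ (\<open>essential_numerical_range_eq\<close>). This set is closed,
  and it is bounded by the norm of $T$ because of Hoelder's inequality.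

  For convexity (\<open>convex_combination_in_closure\<close>), take $l$ and $m$ in the intersection, a
  vector $x$ with $B(x, x)$ near $l$, and then a vector $y$ with $B(y, y)$ near $m$ that is
  supported far beyond the support of $x$. For disjoint supports, $J$ is additive and $p$-th powers
  of norms add. Hence $z = u^{1/p} x + v^{1/p} y$ with $u + v = 1$ is a unit vector, and $B(z, z)$
  is $u B(x, x) + v B(y, y)$ up to multiples of $B(x, y)$ and $B(y, x)$ by factors of modulus at
  most 1. Both cross terms are small when $y$ is far out: $B(x, y)$ only sees a tail of
  $Tx \in \ell_p$ (\<open>form_left_tail_small\<close>), and $B(y, x) = \langle y, a \rangle$ only
  sees a tail of the sequence $a \in \ell_q$ that represents the functional $B(\cdot, x)$
  (\<open>form_right_tail_small\<close>).

  In general $J$ is not additive, and estimates for it are awkward when $p \neq 2$. All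
  decompositions below are therefore into vectors with disjoint supports. In particular, a vector
  is compared only with its own truncations (\<open>form_truncation\<close>).
\<close>

section \<open>Restrictions and norms of sequences\<close>

definition cut :: "nat set \<Rightarrow> (nat \<Rightarrow> complex) \<Rightarrow> nat \<Rightarrow> complex" where
  "cut A x = (\<lambda>j. if j \<in> A then x j else 0)"

lemma cut_ell:
  assumes "x \<in> ell p" shows "cut A x \<in> ell p"
  unfolding ell_def
proof (rule CollectI, rule summable_comparison_test')
  show "summable (\<lambda>j. cmod (x j) powr p)" using assms by (simp add: ell_def)
  show "norm (cmod (cut A x j) powr p) \<le> cmod (x j) powr p" if "j \<ge> 0" for j
    by (simp add: cut_def)
qed

lemma cut_add_cut_compl: "x = (\<lambda>j. cut A x j + cut (- A) x j)"
  by (auto simp: cut_def)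

lemma finite_support_ell: "(\<And>j. j \<ge> M \<Longrightarrow> x j = 0) \<Longrightarrow> x \<in> ell p"
  unfolding ell_def by (intro CollectI summable_finite[of "{..<M}"]) simp_all

lemma pairing_cut_left:
  assumes "\<And>j. j \<notin> A \<Longrightarrow> y j = 0"
  shows "pairing (cut A x) y = pairing x y"
  unfolding pairing_def cut_def by (rule arg_cong[of _ _ suminf]) (auto simp: assms)

lemma pairing_cut_right:
  assumes "\<And>j. j \<notin> A \<Longrightarrow> x j = 0"
  shows "pairing x (cut A y) = pairing x y"
  unfolding pairing_def cut_def by (rule arg_cong[of _ _ suminf]) (auto simp: assms)

lemma ell_norm_nonneg: "0 \<le> ell_norm p x"
  by (simp add: ell_norm_def)

lemma ell_norm_powr:
  assumes "0 < p" "x \<in> ell p"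
  shows "ell_norm p x powr p = (\<Sum>j. cmod (x j) powr p)"
proof -
  have "0 \<le> (\<Sum>j. cmod (x j) powr p)"
    using assms by (intro suminf_nonneg) (auto simp: ell_def)
  then show ?thesis using assms by (simp add: ell_norm_def powr_powr)
qed

lemma ell_norm_scale:
  assumes "0 < p" "x \<in> ell p"
  shows "ell_norm p (\<lambda>j. c * x j) = cmod c * ell_norm p x"
proof -
  have "(\<Sum>j. cmod (c * x j) powr p) = cmod c powr p * (\<Sum>j. cmod (x j) powr p)"
    using assms by (simp add: norm_mult powr_mult suminf_mult ell_def)
  then show ?thesis using assms by (simp add: ell_norm_def powr_mult powr_powr)
qed

lemma scale_ell: "x \<in> ell p \<Longrightarrow> (\<lambda>j. c * x j) \<in> ell p"
  by (simp add: ell_def norm_mult powr_mult summable_mult)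

lemma ell_norm_eq_0:
  assumes "0 < p" "x \<in> ell p" "ell_norm p x = 0"
  shows "x j = 0"
proof -
  have "(\<Sum>j. cmod (x j) powr p) = 0" 
    using ell_norm_powr[OF assms(1,2)] assms(1,3) by simp
  then have "cmod (x j) powr p = 0"
    using assms(2) suminf_eq_zero_iff[of "\<lambda>j. cmod (x j) powr p"] by (simp add: ell_def)
  then show ?thesis by simp
qed

lemma ell_norm_disjoint_sum:
  assumes "0 < p" "x \<in> ell p" "y \<in> ell p" "\<And>j. x j = 0 \<or> y j = 0"
  shows "ell_norm p (\<lambda>j. x j + y j) powr p = ell_norm p x powr p + ell_norm p y powr p"
    "(\<lambda>j. x j + y j) \<in> ell p"
proof -
  have *: "cmod (x j + y j) powr p = cmod (x j) powr p + cmod (y j) powr p" for j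
    using assms(4)[of j] assms(1) by auto
  show ell: "(\<lambda>j. x j + y j) \<in> ell p"
    using assms(2,3) by (simp add: ell_def * summable_add)
  show "ell_norm p (\<lambda>j. x j + y j) powr p = ell_norm p x powr p + ell_norm p y powr p"
    unfolding ell_norm_powr[OF assms(1) ell] ell_norm_powr[OF assms(1,2)]
      ell_norm_powr[OF assms(1,3)] *
    using assms(2,3) by (intro suminf_add[symmetric]) (simp_all add: ell_def)
qed

text \<open>This is the source of smallness throughout: whatever is supported beyond \<open>n\<close>
  pairs only with such a tail.\<close>

lemma ell_norm_tail_tendsto_0:
  assumes "0 < p" "x \<in> ell p"
  shows "(\<lambda>n. ell_norm p (cut {n..} x)) \<longlonglongrightarrow> 0"
proof -
  have s: "summable (\<lambda>j. cmod (x j) powr p)" using assms by (simp add: ell_def)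
  have eq: "(\<Sum>j. cmod (cut {n..} x j) powr p)
      = (\<Sum>j. cmod (x j) powr p) - (\<Sum>j<n. cmod (x j) powr p)" for n
  proof -
    have "summable (\<lambda>j. cmod (cut {n..} x j) powr p)"
      using cut_ell[OF assms(2)] by (simp add: ell_def)
    from suminf_split_initial_segment[OF this, of n]
    have "(\<Sum>j. cmod (cut {n..} x j) powr p) = (\<Sum>j. cmod (x (j + n)) powr p)"
      by (simp add: cut_def)
    with suminf_split_initial_segment[OF s, of n] show ?thesis by simp
  qed
  have "(\<lambda>n. (\<Sum>j. cmod (x j) powr p) - (\<Sum>j<n. cmod (x j) powr p)) \<longlonglongrightarrow>
      (\<Sum>j. cmod (x j) powr p) - (\<Sum>j. cmod (x j) powr p)"
    by (intro tendsto_intros summable_LIMSEQ s)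
  then have *: "(\<lambda>n. \<Sum>j. cmod (cut {n..} x j) powr p) \<longlonglongrightarrow> 0"
    by (simp add: eq)
  show ?thesis unfolding ell_norm_def
  proof (rule tendsto_zero_powrI[OF * tendsto_const])
    show "\<forall>\<^sub>F n in sequentially. 0 \<le> (\<Sum>j. cmod (cut {n..} x j) powr p)"
      using cut_ell[OF assms(2)] by (intro always_eventually allI suminf_nonneg) (auto simp: ell_def)
    show "0 < 1 / p" using assms by simp
  qed
qed

section \<open>Duality between conjugate exponents\<close>

locale conjugate_exponents =
  fixes p q :: real
  assumes p_gt_1: "1 < p" and conj: "1 / p + 1 / q = 1"
begin

lemma q_eq: "q = p / (p - 1)"
proof -
  have "q \<noteq> 0" using conj p_gt_1 by auto
  with conj p_gt_1 show ?thesis by (simp add: field_simps)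
qed

lemma q_gt_1: "1 < q" using p_gt_1 by (simp add: q_eq field_simps)

lemma conj_exponent_eq: "conj_exponent p = q" by (simp add: conj_exponent_def q_eq)

lemma p_minus_1_times_q: "(p - 1) * q = p" using p_gt_1 by (simp add: q_eq)

lemma p_over_q: "p / q = p - 1" using p_gt_1 by (simp add: q_eq)

lemma sym: "conjugate_exponents q p"
  using q_gt_1 conj by unfold_locales simp_all

text \<open>Hoelder's inequality comes from Young's inequality for the normalised terms
  $|x_j| / \|x\|$ and $|y_j| / \|y\|$, whose bounds sum to $1/p + 1/q = 1$. The case of a zero
  norm has to be separated because of the division.\<close>

lemma holder:
  assumes x: "x \<in> ell p" and y: "y \<in> ell q"
  shows "summable (\<lambda>j. cmod (x j) * cmod (y j))"
    and "(\<Sum>j. cmod (x j) * cmod (y j)) \<le> ell_norm p x * ell_norm q y"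
proof -
  let ?a = "ell_norm p x" and ?b = "ell_norm q y"
  have "summable (\<lambda>j. cmod (x j) * cmod (y j)) \<and> (\<Sum>j. cmod (x j) * cmod (y j)) \<le> ?a * ?b"
  proof (cases "?a = 0 \<or> ?b = 0")
    case True
    then have zero: "(\<lambda>j. cmod (x j) * cmod (y j)) = (\<lambda>j. 0)"
      using ell_norm_eq_0[OF _ x] ell_norm_eq_0[OF _ y] p_gt_1 q_gt_1 by auto
    show ?thesis unfolding zero by (simp add: ell_norm_nonneg)
  next
    case False
    then have a: "?a > 0" and b: "?b > 0"
      using ell_norm_nonneg[of p x] ell_norm_nonneg[of q y] by auto
    have sx: "summable (\<lambda>j. cmod (x j) powr p)" and sy: "summable (\<lambda>j. cmod (y j) powr q)"
      using x y by (auto simp: ell_def)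
    define g where "g j = (cmod (x j) powr p / ?a powr p) / p
      + (cmod (y j) powr q / ?b powr q) / q" for j
    have "g sums (((\<Sum>j. cmod (x j) powr p) / ?a powr p) / p
        + ((\<Sum>j. cmod (y j) powr q) / ?b powr q) / q)"
      unfolding g_def using sx sy by (intro sums_add sums_divide summable_sums)
    also have "((\<Sum>j. cmod (x j) powr p) / ?a powr p) / p
        + ((\<Sum>j. cmod (y j) powr q) / ?b powr q) / q = 1"
      using ell_norm_powr[OF _ x, symmetric] ell_norm_powr[OF _ y, symmetric] p_gt_1 q_gt_1 a b conj
      by simp
    finally have g: "g sums 1" .
    have le: "cmod (x j) * cmod (y j) \<le> ?a * ?b * g j" for j
    proof -
      have "(cmod (x j) / ?a) * (cmod (y j) / ?b) \<le> g j"
        using Youngs_inequality[OF p_gt_1 q_gt_1 conj, of "cmod (x j) / ?a" "cmod (y j) / ?b"] a b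
        by (simp add: g_def powr_divide)
      then show ?thesis using a b by (simp add: field_simps)
    qed
    have gs: "(\<lambda>j. ?a * ?b * g j) sums (?a * ?b)" using sums_mult[OF g, of "?a * ?b"] by simp
    have s: "summable (\<lambda>j. cmod (x j) * cmod (y j))"
      by (rule summable_comparison_test'[OF sums_summable[OF gs], of 0]) (simp add: le)
    then show ?thesis
      using sums_le[OF le summable_sums[OF s] gs] by simp
  qed
  then show "summable (\<lambda>j. cmod (x j) * cmod (y j))"
    and "(\<Sum>j. cmod (x j) * cmod (y j)) \<le> ?a * ?b" by auto
qed

lemma pairing_summable:
  assumes "x \<in> ell p" "y \<in> ell q"
  shows "summable (\<lambda>j. x j * cnj (y j))"
  by (rule summable_norm_cancel) (simp add: norm_mult holder(1)[OF assms])

lemma pairing_bound: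
  assumes "x \<in> ell p" "y \<in> ell q"
  shows "cmod (pairing x y) \<le> ell_norm p x * ell_norm q y"
proof -
  have "cmod (pairing x y) \<le> (\<Sum>j. cmod (x j * cnj (y j)))"
    unfolding pairing_def by (rule summable_norm) (simp add: norm_mult holder(1)[OF assms])
  also have "\<dots> \<le> ell_norm p x * ell_norm q y"
    using holder(2)[OF assms] by (simp add: norm_mult)
  finally show ?thesis .
qed

lemma pairing_add_left:
  assumes "x \<in> ell p" "x' \<in> ell p" "y \<in> ell q"
  shows "pairing (\<lambda>j. x j + x' j) y = pairing x y + pairing x' y"
  unfolding pairing_def
  by (simp add: distrib_right suminf_add pairing_summable assms)

lemma pairing_add_right:
  assumes "x \<in> ell p" "y \<in> ell q" "y' \<in> ell q"
  shows "pairing x (\<lambda>j. y j + y' j) = pairing x y + pairing x y'"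
  unfolding pairing_def
  by (simp add: distrib_left suminf_add pairing_summable assms)

lemma pairing_scale_left:
  assumes "x \<in> ell p" "y \<in> ell q"
  shows "pairing (\<lambda>j. c * x j) y = c * pairing x y"
  unfolding pairing_def
  using suminf_mult[OF pairing_summable[OF assms], of c] by (simp add: mult.assoc)

lemma pairing_scale_right:
  assumes "x \<in> ell p" "y \<in> ell q"
  shows "pairing x (\<lambda>j. c * y j) = cnj c * pairing x y"
  unfolding pairing_def
  using suminf_mult[OF pairing_summable[OF assms], of "cnj c"] by (simp add: mult_ac)

lemma cmod_duality_map: "cmod (duality_map p x j) = cmod (x j) powr (p - 1)"
  using powr_mult_base[of "cmod (x j)" "p - 2"] by (simp add: duality_map_def norm_mult)

lemma cmod_duality_map_powr: "cmod (duality_map p x j) powr q = cmod (x j) powr p"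
  by (simp add: cmod_duality_map powr_powr p_minus_1_times_q)

lemma duality_map_ell: "x \<in> ell p \<Longrightarrow> duality_map p x \<in> ell q"
  by (simp add: ell_def cmod_duality_map_powr)

lemma ell_norm_duality_map:
  assumes "x \<in> ell p"
  shows "ell_norm q (duality_map p x) = ell_norm p x powr (p - 1)"
proof -
  have "ell_norm q (duality_map p x) = (ell_norm p x powr p) powr (1 / q)"
    using p_gt_1 ell_norm_powr[OF _ assms] unfolding ell_norm_def cmod_duality_map_powr by simp
  also have "\<dots> = ell_norm p x powr (p - 1)"
    by (simp add: powr_powr p_over_q)
  finally show ?thesis .
qed

lemma duality_map_scale:
  assumes "0 \<le> s"
  shows "duality_map p (\<lambda>j. of_real s * x j) = (\<lambda>j. of_real (s powr (p - 1)) * duality_map p x j)"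
proof
  fix j
  have "s * s powr (p - 2) = s powr (p - 1)"
    using powr_mult_base[OF assms, of "p - 2"] by simp
  then show "duality_map p (\<lambda>j. of_real s * x j) j = of_real (s powr (p - 1)) * duality_map p x j"
    using assms by (simp add: duality_map_def norm_mult powr_mult flip: of_real_mult)
qed

lemma duality_map_disjoint_sum:
  assumes "\<And>j. x j = 0 \<or> y j = 0"
  shows "duality_map p (\<lambda>j. x j + y j) = (\<lambda>j. duality_map p x j + duality_map p y j)"
proof
  fix j show "duality_map p (\<lambda>j. x j + y j) j = duality_map p x j + duality_map p y j"
    using assms[of j] by (auto simp: duality_map_def)
qed

text \<open>
  The coefficients $a_n$ of a bounded functional $f$ are its (conjugated) values at the unit
  vectors. They lie in $\ell_q$ because testing $f$ on a truncation of $J_q(a)$, where $J_q$ is the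
  duality map of $\ell_q$, gives $S \le C S^{1/p}$ for the partial sums $S$ of
  $\sum |a_j|^q$, and hence $S \le C^q$. On finitely supported vectors the representation follows
  by linearity alone.
\<close>

lemma bounded_functional_representation:
  fixes f :: "(nat \<Rightarrow> complex) \<Rightarrow> complex"
  assumes add: "\<And>x y. x \<in> ell p \<Longrightarrow> y \<in> ell p \<Longrightarrow> f (\<lambda>j. x j + y j) = f x + f y"
    and scale: "\<And>c x. x \<in> ell p \<Longrightarrow> f (\<lambda>j. c * x j) = c * f x"
    and bound: "\<And>x. x \<in> ell p \<Longrightarrow> cmod (f x) \<le> C * ell_norm p x"
  obtains a where "a \<in> ell q"
    "\<And>M x. (\<And>j. j \<ge> M \<Longrightarrow> x j = 0) \<Longrightarrow> f x = pairing x a"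
proof -
  define e :: "nat \<Rightarrow> nat \<Rightarrow> complex" where "e n = (\<lambda>j. if j = n then 1 else 0)" for n
  define a where "a n = cnj (f (e n))" for n
  have e: "e n \<in> ell p" for n
    by (rule finite_support_ell[of "Suc n"]) (auto simp: e_def)
  have rep: "f (cut {..<n} x) = (\<Sum>j<n. x j * cnj (a j))" for n x
  proof (induction n)
    case 0
    have "(\<lambda>j. 0 * e 0 j) = cut {..<0} x" by (auto simp: cut_def)
    then show ?case using scale[OF e, of 0 0] by simp
  next
    case (Suc n)
    have c: "cut {..<n} x \<in> ell p"
      by (rule finite_support_ell[of n]) (auto simp: cut_def)
    have "cut {..<Suc n} x = (\<lambda>j. cut {..<n} x j + x n * e n j)"
      by (auto simp: cut_def e_def less_Suc_eq)
    then show ?case using add[OF c scale_ell[OF e]] scale[OF e] Suc by (simp add: a_def)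
  qed
  have "(\<Sum>j<n. cmod (a j) powr q) \<le> \<bar>C\<bar> powr q" for n
  proof (cases "(\<Sum>j<n. cmod (a j) powr q) = 0")
    case False
    define S where "S = (\<Sum>j<n. cmod (a j) powr q)"
    have S: "S > 0" using False by (simp add: S_def order_less_le sum_nonneg)
    define x where "x = cut {..<n} (duality_map q a)"
    have x: "x \<in> ell p"
      by (rule finite_support_ell[of n]) (auto simp: x_def cut_def)
    have "duality_map q a j * cnj (a j) = of_real (cmod (a j) powr q)" for j
    proof -
      have "duality_map q a j * cnj (a j) = (a j * cnj (a j)) * of_real (cmod (a j) powr (q - 2))"
        by (simp add: duality_map_def)
      also have "\<dots> = of_real (cmod (a j) ^ 2 * cmod (a j) powr (q - 2))"
        by (simp only: of_real_mult complex_norm_square)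
      also have "cmod (a j) ^ 2 * cmod (a j) powr (q - 2) = cmod (a j) powr q"
        by (cases "a j = 0") (simp_all add: flip: powr_add powr_numeral)
      finally show ?thesis .
    qed
    then have fx: "f x = of_real S" by (simp add: x_def rep S_def)
    have "(\<Sum>j. cmod (x j) powr p) = (\<Sum>j<n. cmod (x j) powr p)"
      by (rule suminf_finite) (auto simp: x_def cut_def)
    also have "\<dots> = S" unfolding S_def
      by (rule sum.cong)
        (auto simp: x_def cut_def conjugate_exponents.cmod_duality_map_powr[OF sym])
    finally have nx: "ell_norm p x = S powr (1 / p)" by (simp add: ell_norm_def)
    have "S = S powr (1 / p) * S powr (1 / q)" using S conj by (simp flip: powr_add)
    moreover have "S \<le> \<bar>C\<bar> * S powr (1 / p)"
      using order_trans[OF bound[OF x] mult_right_mono[OF abs_ge_self[of C] ell_norm_nonneg]] S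
      by (simp add: fx nx)
    ultimately have "S powr (1 / p) * S powr (1 / q) \<le> S powr (1 / p) * \<bar>C\<bar>"
      by (simp add: mult.commute)
    then have "S powr (1 / q) \<le> \<bar>C\<bar>" using S by simp
    then have "(S powr (1 / q)) powr q \<le> \<bar>C\<bar> powr q"
      using q_gt_1 by (intro powr_mono2) auto
    then show ?thesis using S q_gt_1 by (simp add: powr_powr flip: S_def)
  qed simp
  then have a: "a \<in> ell q" unfolding ell_def
    by (auto intro!: summableI_nonneg_bounded)
  have "f x = pairing x a" if "\<And>j. j \<ge> M \<Longrightarrow> x j = 0" for M x
  proof -
    have "x = cut {..<M} x" using that by (fastforce simp: cut_def)
    then have "f x = (\<Sum>j<M. x j * cnj (a j))" using rep[of M x] by simp
    also have "\<dots> = pairing x a" unfolding pairing_def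
      using that by (intro suminf_finite[symmetric]) auto
    finally show ?thesis .
  qed
  with a that show ?thesis by blast
qed

end

section \<open>The form $\langle Tx, J(y) \rangle$\<close>

locale ell_operator = conjugate_exponents +
  fixes T :: "(nat \<Rightarrow> complex) \<Rightarrow> nat \<Rightarrow> complex" and C :: real
  assumes T_ell: "x \<in> ell p \<Longrightarrow> T x \<in> ell p"
    and T_add: "x \<in> ell p \<Longrightarrow> y \<in> ell p \<Longrightarrow> T (\<lambda>j. x j + y j) = (\<lambda>j. T x j + T y j)"
    and T_scale: "x \<in> ell p \<Longrightarrow> T (\<lambda>j. c * x j) = (\<lambda>j. c * T x j)"
    and T_bound: "x \<in> ell p \<Longrightarrow> ell_norm p (T x) \<le> C * ell_norm p x"
    and C_nonneg: "0 \<le> C"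
begin

definition duality_form :: "(nat \<Rightarrow> complex) \<Rightarrow> (nat \<Rightarrow> complex) \<Rightarrow> complex" where
  "duality_form x y = pairing (T x) (duality_map p y)"

lemma form_bound:
  assumes "x \<in> ell p" "y \<in> ell p"
  shows "cmod (duality_form x y) \<le> C * ell_norm p x * ell_norm p y powr (p - 1)"
proof -
  have "cmod (duality_form x y) \<le> ell_norm p (T x) * ell_norm p y powr (p - 1)"
    unfolding duality_form_def
    using pairing_bound[OF T_ell[OF assms(1)] duality_map_ell[OF assms(2)]]
    by (simp add: ell_norm_duality_map assms)
  also have "\<dots> \<le> C * ell_norm p x * ell_norm p y powr (p - 1)"
    by (intro mult_right_mono T_bound assms) simp
  finally show ?thesis .
qed

lemma form_scale_left: "x \<in> ell p \<Longrightarrow> y \<in> ell p \<Longrightarrow> duality_form (\<lambda>j. c * x j) y = c * duality_form x y"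
  unfolding duality_form_def by (simp add: T_scale pairing_scale_left T_ell duality_map_ell)

lemma form_scale_right:
  "0 \<le> s \<Longrightarrow> x \<in> ell p \<Longrightarrow> y \<in> ell p \<Longrightarrow>
    duality_form x (\<lambda>j. of_real s * y j) = of_real (s powr (p - 1)) * duality_form x y"
  unfolding duality_form_def
  by (simp add: duality_map_scale pairing_scale_right T_ell duality_map_ell)

lemma form_scale_diag:
  assumes "0 \<le> s" "x \<in> ell p"
  shows "duality_form (\<lambda>j. of_real s * x j) (\<lambda>j. of_real s * x j) = of_real (s powr p) * duality_form x x"
  using powr_mult_base[OF assms(1), of "p - 1"] assms
  by (simp add: form_scale_left form_scale_right scale_ell flip: of_real_mult mult.assoc)

lemma form_add_left:
  "x \<in> ell p \<Longrightarrow> x' \<in> ell p \<Longrightarrow> y \<in> ell p \<Longrightarrow>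
    duality_form (\<lambda>j. x j + x' j) y = duality_form x y + duality_form x' y"
  unfolding duality_form_def by (simp add: T_add pairing_add_left T_ell duality_map_ell)

lemma form_disjoint_add_right:
  "x \<in> ell p \<Longrightarrow> y \<in> ell p \<Longrightarrow> y' \<in> ell p \<Longrightarrow> (\<And>j. y j = 0 \<or> y' j = 0) \<Longrightarrow>
    duality_form x (\<lambda>j. y j + y' j) = duality_form x y + duality_form x y'"
  unfolding duality_form_def
  by (simp add: duality_map_disjoint_sum pairing_add_right T_ell duality_map_ell)

section \<open>Unit vectors supported far out\<close>

definition block_unit :: "nat \<Rightarrow> (nat \<Rightarrow> complex) set" where
  "block_unit N = {x. ell_norm p x = 1 \<and> (\<exists>M. \<forall>j. j < N \<or> M \<le> j \<longrightarrow> x j = 0)}"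

lemma block_unit_ell: "x \<in> block_unit N \<Longrightarrow> x \<in> ell p"
  unfolding block_unit_def using finite_support_ell by blast

definition tail_range :: "nat \<Rightarrow> complex set" where
  "tail_range N = (\<lambda>x. duality_form x x) ` block_unit N"

lemma tail_range_bounded: "tail_range N \<subseteq> cball 0 C"
proof
  fix l assume "l \<in> tail_range N"
  then obtain x where "l = duality_form x x" "x \<in> block_unit N" unfolding tail_range_def by blast
  then show "l \<in> cball 0 C"
    using form_bound[of x x] block_unit_ell[of x N] by (simp add: block_unit_def)
qed

text \<open>Boundedness and escape to infinity already force weak convergence to 0: a fixed
  $y \in \ell_q$ is met only in its tail.\<close>

lemma block_units_weakly_null:
  assumes "\<And>n. x n \<in> block_unit n"
  shows "weakly_null p x"
  unfolding weakly_null_def conj_exponent_eq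
proof
  fix y assume y: "y \<in> ell q"
  have "cmod (pairing (x n) y) \<le> ell_norm q (cut {n..} y)" for n
  proof -
    have "pairing (x n) y = pairing (x n) (cut {n..} y)"
      using assms[of n] by (intro pairing_cut_right[symmetric]) (auto simp: block_unit_def)
    then show ?thesis
      using pairing_bound[OF block_unit_ell[OF assms] cut_ell[OF y], of n "{n..}"] assms[of n]
      by (simp add: block_unit_def)
  qed
  then show "(\<lambda>n. pairing (x n) y) \<longlonglongrightarrow> 0"
    using q_gt_1 by (intro Lim_null_comparison[OF _ ell_norm_tail_tendsto_0[OF _ y]]) auto
qed

text \<open>The vector $J(y)$ has the support of $y$ and norm 1, so only the tail of $Tx$ matters.\<close>

lemma form_left_tail_small:
  assumes "x \<in> ell p" "e > 0"
  shows "\<exists>K. \<forall>n\<ge>K. \<forall>y\<in>block_unit n. cmod (duality_form x y) < e"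
proof -
  have "(\<lambda>n. ell_norm p (cut {n..} (T x))) \<longlonglongrightarrow> 0"
    using p_gt_1 T_ell[OF assms(1)] by (intro ell_norm_tail_tendsto_0) auto
  then obtain K where K: "\<And>n. n \<ge> K \<Longrightarrow> ell_norm p (cut {n..} (T x)) < e"
    using assms(2) LIMSEQ_D[of _ 0 e] by (fastforce simp: ell_norm_nonneg)
  have "cmod (duality_form x y) < e" if "n \<ge> K" "y \<in> block_unit n" for n y
  proof -
    have y: "y \<in> ell p" using that by (simp add: block_unit_ell)
    have "duality_form x y = pairing (cut {n..} (T x)) (duality_map p y)"
      unfolding duality_form_def using that(2)
      by (intro pairing_cut_left[symmetric]) (auto simp: block_unit_def duality_map_def)
    then have "cmod (duality_form x y) \<le> ell_norm p (cut {n..} (T x))"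
      using pairing_bound[OF cut_ell[OF T_ell[OF assms(1)]] duality_map_ell[OF y], of "{n..}"]
        that(2) by (simp add: ell_norm_duality_map y block_unit_def)
    with K[OF that(1)] show ?thesis by simp
  qed
  then show ?thesis by blast
qed

text \<open>
  Unlike $y$, the image $Ty$ may be supported anywhere, in particular on the support of $x$. But the
  functional $y \mapsto \langle Ty, J(x) \rangle$ is represented by a sequence in $\ell_q$ (the
  adjoint of $T$ at $J(x)$), and $y$ only sees the tail of that sequence.
\<close>

lemma form_right_tail_small:
  assumes x: "x \<in> ell p" and "e > 0"
  shows "\<exists>K. \<forall>n\<ge>K. \<forall>y\<in>block_unit n. cmod (duality_form y x) < e"
proof -
  obtain a where a: "a \<in> ell q"
    and rep: "\<And>M y. (\<And>j. j \<ge> M \<Longrightarrow> y j = 0) \<Longrightarrow> duality_form y x = pairing y a"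
  proof (rule bounded_functional_representation[of "\<lambda>y. duality_form y x" "C * ell_norm p x powr (p - 1)"])
    show "cmod (duality_form y x) \<le> C * ell_norm p x powr (p - 1) * ell_norm p y" if "y \<in> ell p" for y
      using form_bound[OF that x] by (simp add: mult_ac)
  qed (use x form_add_left form_scale_left in auto)
  have "(\<lambda>n. ell_norm q (cut {n..} a)) \<longlonglongrightarrow> 0"
    using q_gt_1 a by (intro ell_norm_tail_tendsto_0) auto
  then obtain K where K: "\<And>n. n \<ge> K \<Longrightarrow> ell_norm q (cut {n..} a) < e"
    using assms(2) LIMSEQ_D[of _ 0 e] by (fastforce simp: ell_norm_nonneg)
  have "cmod (duality_form y x) < e" if "n \<ge> K" "y \<in> block_unit n" for n y
  proof -
    have "duality_form y x = pairing y a" using that(2) rep by (auto simp: block_unit_def)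
    also have "\<dots> = pairing y (cut {n..} a)"
      using that(2) by (intro pairing_cut_right[symmetric]) (auto simp: block_unit_def)
    finally have "cmod (duality_form y x) \<le> ell_norm q (cut {n..} a)"
      using pairing_bound[OF block_unit_ell[OF that(2)] cut_ell[OF a], of "{n..}"]
        that(2) by (simp add: block_unit_def)
    with K[OF that(1)] show ?thesis by simp
  qed
  then show ?thesis by blast
qed

section \<open>Convex combinations\<close>

text \<open>
  The point $m$ has to be approximable by vectors arbitrarily far out, because the place where $y$
  may begin depends on $x$. This is why the hypotheses concern all $V_n$, although the conclusion is
  about a single one.
\<close>

lemma convex_combination_in_closure:
  assumes l: "\<And>n. l \<in> closure (tail_range n)" and m: "\<And>n. m \<in> closure (tail_range n)"
    and uv: "0 \<le> u" "0 \<le> v" "u + v = 1"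
  shows "u *\<^sub>R l + v *\<^sub>R m \<in> closure (tail_range N)"
  unfolding closure_approachable
proof (intro allI impI)
  fix e :: real assume "e > 0"
  then have e: "e / 4 > 0" by simp
  obtain x where x: "x \<in> block_unit N" and xl: "cmod (duality_form x x - l) < e / 4"
    using l[of N] e unfolding closure_approachable tail_range_def dist_norm by blast
  have xe: "x \<in> ell p" by (rule block_unit_ell[OF x])
  obtain M where M: "\<And>j. j < N \<or> M \<le> j \<Longrightarrow> x j = 0" and nx: "ell_norm p x = 1"
    using x unfolding block_unit_def by blast
  obtain K1 where K1: "\<And>n y. n \<ge> K1 \<Longrightarrow> y \<in> block_unit n \<Longrightarrow> cmod (duality_form x y) < e / 4"
    using form_left_tail_small[OF xe e] by blast
  obtain K2 where K2: "\<And>n y. n \<ge> K2 \<Longrightarrow> y \<in> block_unit n \<Longrightarrow> cmod (duality_form y x) < e / 4"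
    using form_right_tail_small[OF xe e] by blast
  \<comment> \<open>Beyond \<open>K\<close> both cross terms are small and the support of \<open>x\<close> has ended.\<close>
  define K where "K = Max {K1, K2, M, N}"
  have K: "K \<ge> K1" "K \<ge> K2" "K \<ge> M" "K \<ge> N" by (auto simp: K_def)
  obtain y where y: "y \<in> block_unit K" and ym: "cmod (duality_form y y - m) < e / 4"
    using m[of K] e unfolding closure_approachable tail_range_def dist_norm by blast
  have ye: "y \<in> ell p" by (rule block_unit_ell[OF y])
  obtain M' where M': "\<And>j. j < K \<or> M' \<le> j \<Longrightarrow> y j = 0" and ny: "ell_norm p y = 1"
    using y unfolding block_unit_def by blast
  \<comment> \<open>The weights are \<open>p\<close>-th roots since \<open>p\<close>-th powers of norms add for disjoint supports.\<close>
  define s r where "s = u powr (1 / p)" and "r = v powr (1 / p)"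
  have s: "0 \<le> s" "s \<le> 1" "s powr p = u" and r: "0 \<le> r" "r \<le> 1" "r powr p = v"
    using uv p_gt_1 powr_mono2[of "1 / p" u 1] powr_mono2[of "1 / p" v 1]
    by (auto simp: s_def r_def powr_powr)
  define sx ry where "sx = (\<lambda>j. of_real s * x j)" and "ry = (\<lambda>j. of_real r * y j)"
  have sxe: "sx \<in> ell p" and rye: "ry \<in> ell p" by (simp_all add: sx_def ry_def scale_ell xe ye)
  have disj: "sx j = 0 \<or> ry j = 0" for j
    using M[of j] M'[of j] K by (cases "j < K") (auto simp: sx_def ry_def)
  define z where "z = (\<lambda>j. sx j + ry j)"
  have ze: "z \<in> ell p" unfolding z_def
    using p_gt_1 sxe rye disj by (intro ell_norm_disjoint_sum(2)) auto
  have "ell_norm p z powr p = ell_norm p sx powr p + ell_norm p ry powr p" unfolding z_def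
    using p_gt_1 sxe rye disj by (intro ell_norm_disjoint_sum(1)) auto
  also have "\<dots> = 1" using p_gt_1 xe ye s r nx ny uv(3)
    by (simp add: sx_def ry_def ell_norm_scale)
  finally have "(ell_norm p z powr p) powr (1 / p) = 1" by simp
  then have nz: "ell_norm p z = 1"
    using p_gt_1 by (simp add: powr_powr ell_norm_nonneg)
  have "z j = 0" if "j < N \<or> max M M' \<le> j" for j
    using M[of j] M'[of j] that K by (auto simp: z_def sx_def ry_def)
  then have z: "z \<in> block_unit N" using nz unfolding block_unit_def by blast
  have cz: "duality_form z z = duality_form sx sx + duality_form sx ry + (duality_form ry sx + duality_form ry ry)"
    using sxe rye disj ze form_add_left[OF sxe rye ze] unfolding z_def
    by (simp add: form_disjoint_add_right)
  have d1: "duality_form sx sx = of_real u * duality_form x x" "duality_form ry ry = of_real v * duality_form y y"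
    using form_scale_diag[OF s(1) xe] form_scale_diag[OF r(1) ye] s r
    by (simp_all add: sx_def ry_def)
  have small: "cmod (of_real s' * (of_real (r' powr (p - 1)) * w)) \<le> cmod w"
    if "0 \<le> s'" "s' \<le> 1" "0 \<le> r'" "r' \<le> 1" for s' r' w
  proof -
    have "r' powr (p - 1) \<le> 1" using that p_gt_1 powr_mono2[of "p - 1" r' 1] by simp
    then have "s' * r' powr (p - 1) \<le> 1" using that by (simp add: mult_le_one)
    then have "s' * r' powr (p - 1) * cmod w \<le> 1 * cmod w" by (rule mult_right_mono) simp
    then show ?thesis using that by (simp add: norm_mult)
  qed
  have c1: "cmod (duality_form sx ry) < e / 4"
  proof -
    have "duality_form sx ry = of_real s * (of_real (r powr (p - 1)) * duality_form x y)"
      unfolding sx_def ry_def using s r xe ye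
      by (simp add: form_scale_left form_scale_right scale_ell)
    then show ?thesis using small[OF s(1,2) r(1,2), of "duality_form x y"] K1[OF K(1) y] by simp
  qed
  have c2: "cmod (duality_form ry sx) < e / 4"
  proof -
    have "duality_form ry sx = of_real r * (of_real (s powr (p - 1)) * duality_form y x)"
      unfolding sx_def ry_def using s r xe ye
      by (simp add: form_scale_left form_scale_right scale_ell)
    then show ?thesis using small[OF r(1,2) s(1,2), of "duality_form y x"] K2[OF K(2) y] by simp
  qed
  have "duality_form z z - (u *\<^sub>R l + v *\<^sub>R m)
      = (of_real u * (duality_form x x - l) + of_real v * (duality_form y y - m)) + (duality_form sx ry + duality_form ry sx)"
    by (simp add: cz d1 scaleR_conv_of_real algebra_simps)
  then have "cmod (duality_form z z - (u *\<^sub>R l + v *\<^sub>R m))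
      \<le> cmod (of_real u * (duality_form x x - l)) + cmod (of_real v * (duality_form y y - m))
      + (cmod (duality_form sx ry) + cmod (duality_form ry sx))"
    by (simp add: norm_triangle_le add_mono norm_triangle_ineq)
  also have "\<dots> = u * cmod (duality_form x x - l) + v * cmod (duality_form y y - m)
      + (cmod (duality_form sx ry) + cmod (duality_form ry sx))"
    using uv by (simp add: norm_mult)
  also have "\<dots> \<le> u * (e / 4) + v * (e / 4) + (e / 4 + e / 4)"
    using uv xl ym c1 c2 by (intro add_mono mult_left_mono) auto
  also have "\<dots> < e" using \<open>e > 0\<close> distrib_right[of u v "e / 4"] uv(3) by simp
  finally show "\<exists>w\<in>tail_range N. dist w (u *\<^sub>R l + v *\<^sub>R m) < e"
    using z unfolding tail_range_def dist_norm by blast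
qed

section \<open>Truncation of weakly null sequences\<close>

text \<open>
  Let $x = u + w$ be the splitting of $x$ by \<open>A\<close> and its complement. The supports of $u$ and $w$
  are disjoint, so $J(x) = J(u) + J(w)$ and $B(x, x) - B(u, u) = B(w, u) + B(x, w)$. Each of these
  two terms contains a power of $d = \|w\|$, namely $d$ from the first argument and
  $\|J(w)\| = d^{p-1}$ from the second.
\<close>

lemma form_truncation:
  fixes A x
  assumes x: "x \<in> ell p" and nx: "ell_norm p x = 1"
  defines "u \<equiv> cut A x" and "d \<equiv> ell_norm p (cut (- A) x)"
  shows "cmod (duality_form x x - duality_form u u) \<le> C * (d + d powr (p - 1))"
    and "ell_norm p u powr p = 1 - d powr p"
proof -
  define w where "w = cut (- A) x"
  have ue: "u \<in> ell p" and we: "w \<in> ell p" by (simp_all add: u_def w_def cut_ell x)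
  have xuw: "x = (\<lambda>j. u j + w j)" unfolding u_def w_def by (rule cut_add_cut_compl)
  have disj: "u j = 0 \<or> w j = 0" for j by (simp add: u_def w_def cut_def)
  have "ell_norm p x powr p = ell_norm p u powr p + ell_norm p w powr p"
    using ell_norm_disjoint_sum(1)[OF _ ue we disj] p_gt_1 xuw by simp
  then show nu: "ell_norm p u powr p = 1 - d powr p" by (simp add: nx d_def w_def)
  then have "ell_norm p u powr p \<le> 1" by simp
  then have "(ell_norm p u powr p) powr ((p - 1) / p) \<le> 1 powr ((p - 1) / p)"
    using p_gt_1 by (intro powr_mono2) auto
  then have nu': "ell_norm p u powr (p - 1) \<le> 1"
    using p_gt_1 by (simp add: powr_powr)
  have "duality_form x x = duality_form x u + duality_form x w"
    using form_disjoint_add_right[OF x ue we disj] xuw by simp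
  also have "duality_form x u = duality_form u u + duality_form w u"
    using form_add_left[OF ue we ue] xuw by simp
  finally have "duality_form x x - duality_form u u = duality_form w u + duality_form x w" by simp
  then have "cmod (duality_form x x - duality_form u u) \<le> C * d * ell_norm p u powr (p - 1) + C * d powr (p - 1)"
    using form_bound[OF we ue] form_bound[OF x we]
    by (simp add: norm_triangle_le add_mono nx d_def w_def)
  also have "\<dots> \<le> C * d * 1 + C * d powr (p - 1)"
    using nu' C_nonneg by (intro add_right_mono mult_left_mono) (auto simp: d_def ell_norm_nonneg)
  finally show "cmod (duality_form x x - duality_form u u) \<le> C * (d + d powr (p - 1))"
    by (simp add: algebra_simps)
qed

lemma weakly_null_coordinate:
  assumes "weakly_null p x"
  shows "(\<lambda>n. x n j) \<longlonglongrightarrow> 0"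
proof -
  define y :: "nat \<Rightarrow> complex" where "y = (\<lambda>i. if i = j then 1 else 0)"
  have "y \<in> ell q" by (rule finite_support_ell[of "Suc j"]) (auto simp: y_def)
  moreover have "pairing (x n) y = x n j" for n
    unfolding pairing_def by (subst suminf_finite[of "{j}"]) (auto simp: y_def)
  ultimately show ?thesis using assms unfolding weakly_null_def conj_exponent_eq by fastforce
qed

text \<open>
  The coordinates of a weakly null sequence tend to 0, hence so does the part of $x_n$ below $N$.
  Cutting this part off, together with a tail of norm at most $1/(n+1)$, leaves a finitely supported
  vector $u_n$ whose form values have the same limit. Its norm tends to 1, so that the same limit
  remains after normalisation.
\<close>

lemma weakly_null_limit_in_closure:
  assumes x: "\<And>n. x n \<in> ell p" and nx: "\<And>n. ell_norm p (x n) = 1"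
    and wn: "weakly_null p x" and lim: "(\<lambda>n. duality_form (x n) (x n)) \<longlonglongrightarrow> l"
  shows "l \<in> closure (tail_range N)"
proof -
  have p0: "0 < p" using p_gt_1 by simp
  have "\<exists>M. ell_norm p (cut {M..} (x n)) < inverse (real (Suc n))" for n
    using LIMSEQ_D[OF ell_norm_tail_tendsto_0[OF p0 x], of "inverse (real (Suc n))" n]
    by (fastforce simp: ell_norm_nonneg)
  then obtain M where M: "\<And>n. ell_norm p (cut {M n..} (x n)) < inverse (real (Suc n))" by metis
  define d where "d n = ell_norm p (cut (- {N..<M n}) (x n))" for n
  define u where "u n = cut {N..<M n} (x n)" for n
  have ue: "u n \<in> ell p" for n by (simp add: u_def cut_ell x)
  have "d n powr p \<le> (\<Sum>j<N. cmod (x n j) powr p) + inverse (real (Suc n)) powr p" for n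
  proof -
    let ?t = "\<lambda>j. cmod (cut {M n..} (x n) j) powr p"
    let ?h = "\<lambda>j. if j \<in> {..<N} then cmod (x n j) powr p else 0"
    have st: "summable ?t" using cut_ell[OF x] by (simp add: ell_def)
    have sh: "?h sums (\<Sum>j<N. cmod (x n j) powr p)" by (rule sums_If_finite_set) simp
    have sd: "summable (\<lambda>j. cmod (cut (- {N..<M n}) (x n) j) powr p)"
      using cut_ell[OF x] by (simp add: ell_def)
    have "d n powr p = (\<Sum>j. cmod (cut (- {N..<M n}) (x n) j) powr p)"
      unfolding d_def by (rule ell_norm_powr[OF p0 cut_ell[OF x]])
    also have "\<dots> \<le> (\<Sum>j<N. cmod (x n j) powr p) + suminf ?t"
      by (rule sums_le[OF _ summable_sums[OF sd] sums_add[OF sh summable_sums[OF st]]])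
        (auto simp: cut_def)
    also have "suminf ?t = ell_norm p (cut {M n..} (x n)) powr p"
      by (rule ell_norm_powr[OF p0 cut_ell[OF x], symmetric])
    also have "\<dots> \<le> inverse (real (Suc n)) powr p"
      using M[of n] p0 by (intro powr_mono2) (auto simp: ell_norm_nonneg)
    finally show ?thesis by simp
  qed
  moreover have "(\<lambda>n. (\<Sum>j<N. cmod (x n j) powr p) + inverse (real (Suc n)) powr p) \<longlonglongrightarrow> 0 + 0"
  proof (rule tendsto_add)
    have "(\<lambda>n. \<Sum>j<N. cmod (x n j) powr p) \<longlonglongrightarrow> (\<Sum>j<N. 0)"
      using p0 weakly_null_coordinate[OF wn]
      by (intro tendsto_sum tendsto_zero_powrI[OF _ tendsto_const] tendsto_norm_zero) auto
    then show "(\<lambda>n. \<Sum>j<N. cmod (x n j) powr p) \<longlonglongrightarrow> 0" by simp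
    show "(\<lambda>n. inverse (real (Suc n)) powr p) \<longlonglongrightarrow> 0"
      using p0 by (intro tendsto_zero_powrI[OF LIMSEQ_inverse_real_of_nat tendsto_const]) auto
  qed
  ultimately have dp: "(\<lambda>n. d n powr p) \<longlonglongrightarrow> 0"
    by (intro Lim_null_comparison[of "\<lambda>n. d n powr p"]) auto
  then have "(\<lambda>n. (d n powr p) powr (1 / p)) \<longlonglongrightarrow> 0"
    by (rule tendsto_zero_powrI[OF _ tendsto_const]) (use p0 in auto)
  moreover have "(d n powr p) powr (1 / p) = d n" for n
    using p0 by (simp add: powr_powr d_def ell_norm_nonneg)
  ultimately have d: "d \<longlonglongrightarrow> 0" by (simp only:)
  have "(\<lambda>n. C * (d n + d n powr (p - 1))) \<longlonglongrightarrow> C * (0 + 0)"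
    using p_gt_1 by (intro tendsto_mult tendsto_const tendsto_add d
        tendsto_zero_powrI[OF d tendsto_const]) (auto simp: d_def ell_norm_nonneg)
  then have "(\<lambda>n. C * (d n + d n powr (p - 1))) \<longlonglongrightarrow> 0" by simp
  then have "(\<lambda>n. duality_form (x n) (x n) - duality_form (u n) (u n)) \<longlonglongrightarrow> 0"
    by (rule Lim_null_comparison[rotated])
      (simp add: u_def d_def form_truncation(1)[OF x nx])
  from tendsto_diff[OF lim this] have lu: "(\<lambda>n. duality_form (u n) (u n)) \<longlonglongrightarrow> l" by simp
  \<comment> \<open>For the finitely many \<open>n\<close> with \<open>u n = 0\<close> this gives \<open>c n = 0\<close>; only the limit matters.\<close>
  define c where "c n = 1 / ell_norm p (u n)" for n
  define v where "v n = (\<lambda>j. of_real (c n) * u n j)" for n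
  have nu: "ell_norm p (u n) powr p = 1 - d n powr p" for n
    unfolding u_def d_def by (rule form_truncation(2)[OF x nx])
  have c0: "0 \<le> c n" for n by (simp add: c_def ell_norm_nonneg)
  have cp: "c n powr p = 1 / (1 - d n powr p)" for n
    unfolding c_def powr_divide nu by simp
  have "(\<lambda>n. of_real (1 / (1 - d n powr p)) * duality_form (u n) (u n)) \<longlonglongrightarrow> of_real (1 / (1 - 0)) * l"
    by (intro tendsto_mult tendsto_of_real tendsto_divide tendsto_diff tendsto_const dp lu) simp
  then have lv: "(\<lambda>n. duality_form (v n) (v n)) \<longlonglongrightarrow> l"
    by (simp add: v_def form_scale_diag[OF c0 ue] cp)
  have "\<forall>\<^sub>F n in sequentially. d n powr p < 1"
    using dp by (rule order_tendstoD) simp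
  then have "\<forall>\<^sub>F n in sequentially. duality_form (v n) (v n) \<in> closure (tail_range N)"
  proof eventually_elim
    case (elim n)
    have "ell_norm p (u n) \<noteq> 0" using nu[of n] elim by auto
    then have "ell_norm p (v n) = 1" unfolding v_def
      using ell_norm_scale[OF p0 ue, of "of_real (c n)" n] ell_norm_nonneg[of p "u n"]
      by (simp add: c_def norm_divide)
    moreover have "\<forall>j. j < N \<or> M n \<le> j \<longrightarrow> v n j = 0" by (auto simp: v_def u_def cut_def)
    ultimately have "v n \<in> block_unit N" unfolding block_unit_def by blast
    then have "duality_form (v n) (v n) \<in> tail_range N" unfolding tail_range_def by (rule imageI)
    then show ?case by (rule subsetD[OF closure_subset])
  qed
  then show ?thesis
    by (rule Lim_in_closed_set[OF closed_closure _ sequentially_bot lv])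
qed

section \<open>The range as an intersection of closures\<close>

text \<open>A diagonal choice: an approximant from $V_n$ with error at most $1/(n+1)$ for each $n$.\<close>

lemma limit_points_in_range:
  assumes "\<And>n. l \<in> closure (tail_range n)"
  shows "l \<in> essential_numerical_range p T"
proof -
  have "\<exists>x. x \<in> block_unit n \<and> cmod (duality_form x x - l) < inverse (real (Suc n))" for n
  proof -
    have "inverse (real (Suc n)) > 0" by simp
    then show ?thesis
      using assms[of n] unfolding closure_approachable tail_range_def dist_norm by blast
  qed
  then obtain x where x: "\<And>n. x n \<in> block_unit n"
    and le: "\<And>n. cmod (duality_form (x n) (x n) - l) < inverse (real (Suc n))" by metis
  have "(\<lambda>n. duality_form (x n) (x n) - l) \<longlonglongrightarrow> 0"
    by (intro Lim_null_comparison[OF _ LIMSEQ_inverse_real_of_nat] always_eventually allI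
        less_imp_le le)
  then have "(\<lambda>n. duality_form (x n) (x n)) \<longlonglongrightarrow> l" by (rule LIM_zero_cancel)
  moreover have "x n \<in> ell p \<and> ell_norm p (x n) = 1" for n
    using x[of n] block_unit_ell[of "x n" n] by (simp add: block_unit_def)
  ultimately show ?thesis
    using block_units_weakly_null[OF x]
    unfolding essential_numerical_range_def duality_form_def by blast
qed

theorem essential_numerical_range_eq:
  "essential_numerical_range p T = (\<Inter>N. closure (tail_range N))"
proof (intro equalityI subsetI)
  fix l assume "l \<in> essential_numerical_range p T"
  then show "l \<in> (\<Inter>N. closure (tail_range N))"
    using weakly_null_limit_in_closure unfolding essential_numerical_range_def duality_form_def by blast
qed (simp add: limit_points_in_range)

end

section \<open>Compactness and convexity\<close>

theorem theorem3p8: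
  fixes p :: real and T :: "(nat \<Rightarrow> complex) \<Rightarrow> (nat \<Rightarrow> complex)"
  assumes "1 < p"
    and "T \<in> bounded_operators p"
  shows "compact (essential_numerical_range p T) \<and> convex (essential_numerical_range p T)"
proof -
  obtain C where C: "\<And>x. x \<in> ell p \<Longrightarrow> ell_norm p (T x) \<le> C * ell_norm p x"
    using assms(2) unfolding bounded_operators_def by blast
  have "1 / p + 1 / (p / (p - 1)) = 1"
    using assms(1) by (simp add: field_simps)
  then interpret ell_operator p "p / (p - 1)" T "\<bar>C\<bar>"
    using assms C mult_right_mono[OF abs_ge_self[of C] ell_norm_nonneg]
    by unfold_locales (auto simp: bounded_operators_def intro: order_trans)
  let ?W = "\<Inter>N. closure (tail_range N)"
  have "?W \<subseteq> cball 0 \<bar>C\<bar>"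
    using closure_minimal[OF tail_range_bounded closed_cball] by blast
  then have "bounded ?W" by (rule bounded_subset[OF bounded_cball])
  moreover have "closed ?W" by (intro closed_INT) simp
  moreover have "convex ?W"
    unfolding convex_def by (intro ballI allI impI INT_I convex_combination_in_closure) simp_all
  ultimately show ?thesis
    by (simp add: essential_numerical_range_eq compact_eq_bounded_closed)
qed

end
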